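(* Neither the uniformity measure $I_U$ nor the coverage measure $I_C$ satisfies monotonicity.
   Context: For $x,y\in\mathbb{R}^d$, $y$ dominates $x$ if $x_i\le y_i$ for all $i\in[d]$ and $x_j<y_j$ for some $j\in[d]$. A set of alternatives is a finite set $A\subseteq\mathbb{R}^d$ ($d\ge 1$ arbitrary) none of whose elements is dominated by another element of $A$. Let $\|x-y\|=\sum_{i=1}^d|x_i-y_i|$. For a finite set $B\subseteq\mathbb{R}^d$ and nonempty $S\subseteq B$, $I_U(S)=\min_{x,y\in S,\,x\neq y}\|x-y\|$ ($+\infty$ if $|S|=1$; higher is better) and $I_C(S,B)=\max_{a\in B}\min_{s\in S}\|a-s\|$ (lower is better). For a positive integer $k$, $\mathcal{S}(I,B,k)$ is the set of all $S\subseteq B$ with $|S|=k$ that are optimal for $I$ among the size-$k$ subsets of $B$ (maximizing $I_U$, respectively minimizing $I_C(\cdot,B)$). Monotonicity of a measure $I$: for any set of alternatives $A$, any $k\in\mathbb{N}$ and any $S\in\mathcal{S}(I,A,k)$ with $x\in S$: if $y\in\mathbb{R}^d$ dominates $x$, then there exists $S'\in\mathcal{S}(I,(A\setminus\{x\})\cup\{y\},k)$ with $y\in S'$. *)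

theory Defs
  imports "HOL-Library.Extended_Real" "Jordan_Normal_Form.Matrix"
begin

(* A point of R^d is an element of carrier_vec d, so that the dimension d can be quantified over.
   Coordinates are indexed by 0, ..., d - 1. *)

definition dominates :: "real vec \<Rightarrow> real vec \<Rightarrow> bool" where
  "dominates y x \<longleftrightarrow> dim_vec x = dim_vec y \<and>
     (\<forall>i < dim_vec x. x $ i \<le> y $ i) \<and> (\<exists>j < dim_vec x. x $ j < y $ j)"

definition set_of_alternatives :: "nat \<Rightarrow> real vec set \<Rightarrow> bool" where
  "set_of_alternatives d A \<longleftrightarrow> finite A \<and> A \<subseteq> carrier_vec d \<and>
     (\<forall>x \<in> A. \<not> (\<exists>y \<in> A. dominates y x))"

(* Only meaningful when x and y have the same dimension. *)
definition l1_dist :: "real vec \<Rightarrow> real vec \<Rightarrow> real" where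
  "l1_dist x y = (\<Sum>i < dim_vec x. \<bar>x $ i - y $ i\<bar>)"

(* A measure maps a set S and an ambient set B to a value.  Uniformity ignores B. *)

definition uniformity_measure :: "real vec set \<Rightarrow> real vec set \<Rightarrow> ereal" where
  "uniformity_measure S B = (if card S = 1 then \<infinity>
     else ereal (Min {l1_dist x y | x y. x \<in> S \<and> y \<in> S \<and> x \<noteq> y}))"

definition coverage_measure :: "real vec set \<Rightarrow> real vec set \<Rightarrow> real" where
  "coverage_measure S B = Max ((\<lambda>a. Min ((\<lambda>s. l1_dist a s) ` S)) ` B)"

(* The parameter R is the orientation of the measure: R u v means that the value u is at least
   as good as v.  It is (\<ge>) for a measure to be maximized and (\<le>) for one to be minimized. *)

definition optimal_sets ::
  "('v \<Rightarrow> 'v \<Rightarrow> bool) \<Rightarrow> (real vec set \<Rightarrow> real vec set \<Rightarrow> 'v) \<Rightarrow> real vec set \<Rightarrow> nat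
     \<Rightarrow> real vec set set" where
  "optimal_sets R I B k = {S. S \<subseteq> B \<and> card S = k \<and>
     (\<forall>T. T \<subseteq> B \<and> card T = k \<longrightarrow> R (I S B) (I T B))}"

definition monotonicity ::
  "('v \<Rightarrow> 'v \<Rightarrow> bool) \<Rightarrow> (real vec set \<Rightarrow> real vec set \<Rightarrow> 'v) \<Rightarrow> bool" where
  "monotonicity R I \<longleftrightarrow> (\<forall>d A k S x y.
     d \<ge> 1 \<longrightarrow> set_of_alternatives d A \<longrightarrow> k \<ge> 1 \<longrightarrow> S \<in> optimal_sets R I A k \<longrightarrow> x \<in> S \<longrightarrow>
     y \<in> carrier_vec d \<longrightarrow> dominates y x \<longrightarrow>
     (\<exists>S' \<in> optimal_sets R I ((A - {x}) \<union> {y}) k. y \<in> S'))"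

end

theory Submission
  imports Defs
begin

text \<open>
  Both counterexamples start from the planar antichain \<open>(0,3), (1,2), (3,0)\<close>.
  For uniformity with \<open>k = 2\<close>, the pair \<open>{(0,3), (3,0)}\<close> is optimal. Improving \<open>(0,3)\<close> to \<open>(3,3)\<close>
  brings it within distance 3 of both other points, which are themselves at distance 4.
  For coverage with \<open>k = 1\<close>, the middle point \<open>(1,2)\<close> is the optimal centre. Improving it to
  \<open>(6,2)\<close> moves it to distance 7 from \<open>(0,3)\<close>, while \<open>(3,0)\<close> is within distance 6 of everything.
\<close>

definition point :: "real \<Rightarrow> real \<Rightarrow> real vec" where
  "point a b = vec 2 (\<lambda>i. if i = 0 then a else b)"

lemma point_carrier [simp]: "point a b \<in> carrier_vec 2"
  by (simp add: point_def)

lemma dim_vec_point [simp]: "dim_vec (point a b) = 2"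
  by (simp add: point_def)

lemma point_eq_iff [simp]: "point a b = point c d \<longleftrightarrow> a = c \<and> b = d"
proof
  assume "point a b = point c d"
  then have "point a b $ 0 = point c d $ 0" "point a b $ 1 = point c d $ 1"
    by simp_all
  then show "a = c \<and> b = d"
    by (simp add: point_def)
qed simp

lemma l1_dist_point [simp]: "l1_dist (point a b) (point c d) = \<bar>a - c\<bar> + \<bar>b - d\<bar>"
  by (simp add: l1_dist_def point_def numeral_2_eq_2)

lemma dominates_point [simp]:
  "dominates (point c d) (point a b) \<longleftrightarrow> a \<le> c \<and> b \<le> d \<and> (a < c \<or> b < d)"
  by (auto simp: dominates_def point_def numeral_2_eq_2 less_Suc_eq)

text \<open>The sum in \<open>l1_dist\<close> runs over the dimension of its first argument, so
  symmetry relies on equal dimensions.\<close>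

lemma l1_dist_commute: "dim_vec x = dim_vec y \<Longrightarrow> l1_dist x y = l1_dist y x"
  by (simp add: l1_dist_def abs_minus_commute)

text \<open>By symmetry the \<open>Min\<close> ranges over one value; \<open>p \<noteq> q\<close>
  rules out the infinite case.\<close>

lemma uniformity_measure_pair:
  assumes "p \<noteq> q" "dim_vec p = dim_vec q"
  shows "uniformity_measure {p, q} B = ereal (l1_dist p q)"
proof -
  have "{l1_dist x y | x y. x \<in> {p, q} \<and> y \<in> {p, q} \<and> x \<noteq> y} = {l1_dist p q}"
    using assms l1_dist_commute[of p q] by auto
  then show ?thesis
    using assms(1) unfolding uniformity_measure_def by simp
qed

lemma uniformity_measure_point_pair:
  "point a b \<noteq> point c d \<Longrightarrow>
    uniformity_measure {point a b, point c d} B = ereal (\<bar>a - c\<bar> + \<bar>b - d\<bar>)"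
  by (subst uniformity_measure_pair) simp_all

lemma coverage_measure_singleton:
  "coverage_measure {s} B = Max ((\<lambda>a. l1_dist a s) ` B)"
  by (simp add: coverage_measure_def)

lemma set_of_alternatives_triangle:
  "set_of_alternatives 2 {point 0 3, point 1 2, point 3 0}"
  by (simp add: set_of_alternatives_def)

lemma not_monotonicity_uniformity: "\<not> monotonicity (\<ge>) uniformity_measure"
proof
  let ?A = "{point 0 3, point 1 2, point 3 0}"
  let ?B = "?A - {point 0 3} \<union> {point 3 3}"
  \<comment> \<open>The pairs in \<open>?A\<close> have distances 2, 4 and 6; the two endpoints
    attain 6.\<close>
  have "uniformity_measure T ?A \<le> uniformity_measure {point 0 3, point 3 0} ?A"
    if "T \<subseteq> ?A" "card T = 2" for T
  proof -
    obtain p q where T: "T = {p, q}" "p \<noteq> q"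
      using \<open>card T = 2\<close> by (auto simp: card_2_iff)
    then have "p \<in> ?A" "q \<in> ?A"
      using \<open>T \<subseteq> ?A\<close> by auto
    with T show ?thesis
      by (auto simp: uniformity_measure_point_pair)
  qed
  then have "{point 0 3, point 3 0} \<in> optimal_sets (\<ge>) uniformity_measure ?A 2"
    by (auto simp: optimal_sets_def)
  moreover assume "monotonicity (\<ge>) uniformity_measure"
  ultimately obtain S where S: "S \<in> optimal_sets (\<ge>) uniformity_measure ?B 2" "point 3 3 \<in> S"
    unfolding monotonicity_def
    using set_of_alternatives_triangle
    \<comment> \<open>The value \<open>2\<close> serves for both the dimension and
      \<open>k\<close>.\<close>
    by (elim allE[of _ 2] allE[of _ ?A] allE[of _ "{point 0 3, point 3 0}"]
        allE[of _ "point 0 3"] allE[of _ "point 3 3"]) auto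
  then have "S \<subseteq> ?B" "card S = 2"
    by (auto simp: optimal_sets_def)
  then obtain q where "S = {point 3 3, q}" "q \<noteq> point 3 3" "q \<in> {point 1 2, point 3 0}"
    using \<open>point 3 3 \<in> S\<close> by (auto simp: card_2_iff)
  then have "uniformity_measure S ?B = 3"
    by (auto simp: uniformity_measure_point_pair)
  moreover have "uniformity_measure {point 1 2, point 3 0} ?B = 4"
    by (subst uniformity_measure_point_pair) simp_all
  moreover have "uniformity_measure {point 1 2, point 3 0} ?B \<le> uniformity_measure S ?B"
    using S(1) by (auto simp: optimal_sets_def)
  ultimately show False
    by simp
qed

lemma not_monotonicity_coverage: "\<not> monotonicity (\<le>) coverage_measure"
proof
  let ?A = "{point 0 3, point 1 2, point 3 0}"
  let ?B = "?A - {point 1 2} \<union> {point 6 2}"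
  \<comment> \<open>Listing the elements lets the maxima over \<open>?B\<close> be computed
    outright.\<close>
  have B: "?B = {point 0 3, point 3 0, point 6 2}"
    by auto
  \<comment> \<open>The farthest point of \<open>?A\<close> is at distance 4 from (1,2), but at
    distance 6 from either endpoint.\<close>
  have "coverage_measure {point 1 2} ?A \<le> coverage_measure T ?A"
    if "T \<subseteq> ?A" "card T = 1" for T
    using that by (auto simp: card_1_singleton_iff coverage_measure_singleton)
  then have "{point 1 2} \<in> optimal_sets (\<le>) coverage_measure ?A 1"
    by (auto simp: optimal_sets_def)
  moreover assume "monotonicity (\<le>) coverage_measure"
  ultimately obtain S where S: "S \<in> optimal_sets (\<le>) coverage_measure ?B 1" "point 6 2 \<in> S"
    unfolding monotonicity_def
    using set_of_alternatives_triangle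
    by (elim allE[of _ 2] allE[of _ ?A] allE[of _ 1] allE[of _ "{point 1 2}"]
        allE[of _ "point 1 2"] allE[of _ "point 6 2"]) auto
  \<comment> \<open>With \<open>k = 1\<close>, containing the improved point determines the whole
    set.\<close>
  then have "S = {point 6 2}"
    by (auto simp: optimal_sets_def card_1_singleton_iff)
  \<comment> \<open>The distances from (6,2) are 7 and 5; those from (3,0) are 6 and 5.\<close>
  then have "coverage_measure S ?B = 7"
    unfolding B by (simp add: coverage_measure_singleton)
  moreover have "coverage_measure {point 3 0} ?B = 6"
    unfolding B by (simp add: coverage_measure_singleton)
  moreover have "coverage_measure S ?B \<le> coverage_measure {point 3 0} ?B"
    using S(1) by (auto simp: optimal_sets_def)
  ultimately show False
    by simp
qed

theorem proposition14:
  "\<not> monotonicity (\<ge>) uniformity_measure \<and> \<not> monotonicity (\<le>) coverage_measure"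
  using not_monotonicity_uniformity not_monotonicity_coverage by blast

end
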